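(* Let $(g,[\cdot,\cdot],\omega)$ be an $\omega$-Lie superalgebra over a field $\mathbb{K}$ of characteristic zero, let $U$ be a $\mathbb{Z}_2$-graded subspace with $g=[g,g]\oplus U$, and let $\breve g$ (with bracket and bilinear form $\breve\omega$) and $\varphi:\mathrm{QDer}(g)\to\mathrm{End}(\breve g)$ be as defined in the context. Then $\varphi(d)\in\mathrm{Der}(\breve g)$ for all $d\in\mathrm{QDer}(g)$. Moreover, $\varphi(d)$ is compatible if and only if $d$ is compatible.
   Context: $\mathbb{K}$ is a field of characteristic zero. An $\omega$-Lie superalgebra is a $\mathbb{Z}_2$-graded $\mathbb{K}$-vector space $g=g_{\bar 0}\oplus g_{\bar 1}$ with a bilinear bracket $[\cdot,\cdot]:g\times g\to g$ and a bilinear form $\omega:g\times g\to\mathbb{K}$ such that, for all $\alpha,\beta\in\mathbb{Z}_2$ and all homogeneous $x,y,z\in g$ (with $|x|\in\mathbb{Z}_2$ the degree of $x$): (1) $[g_\alpha,g_\beta]\subseteq g_{\alpha+\beta}$; (2) $[x,y]=-(-1)^{|x||y|}[y,x]$; (3) $(-1)^{|x||y|}[[y,z],x]+(-1)^{|y||z|}[[z,x],y]+(-1)^{|x||z|}[[x,y],z]=(-1)^{|x||y|}\omega(y,z)x+(-1)^{|y||z|}\omega(z,x)y+(-1)^{|x||z|}\omega(x,y)z$; (4) $\omega(g_{\bar 0},g_{\bar 1})=0$. $[g,g]$ is the span of all brackets. Construction of $\breve g$: let $t$ be an indeterminate and $\breve g=g\otimes t\,\mathbb{K}[t]/(t^3)=gt\oplus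 gt^2$ (write $xt^i$ for $x\otimes t^i$), graded by $\breve g_\alpha=g_\alpha t\oplus g_\alpha t^2$, with bracket determined by $[xt,yt]=[x,y]t^2$ and $[xt^i,yt^j]=0$ for all other $i,j\in\{1,2\}$, and bilinear form determined by $\breve\omega(xt,yt)=\omega(x,y)$ and $\breve\omega(xt^i,yt^j)=0$ for all other $i,j\in\{1,2\}$. Maps: let $(A,[\cdot,\cdot],\omega_A)$ be $g$ with $\omega$ or $\breve g$ with $\breve\omega$. All conditions are for homogeneous $x\in A$ and all $y\in A$. A homogeneous linear map $d:A\to A$ of degree $|d|$ is: a derivation if $d([x,y])=[d(x),y]+(-1)^{|d||x|}[x,d(y)]$; a quasiderivation if there is a linear map $d'$ homogeneous of degree $|d|$ with $d'([x,y])=[d(x),y]+(-1)^{|d||x|}[x,d(y)]$; compatible if $\omega_A(d(x),y)+(-1)^{|d||x|}\omega_A(x,d(y))=0$. A general linear map is called compatible if both its homogeneous components are. $\mathrm{Der}(A)$ and $\mathrm{QDer}(A)$ are the graded subspaces of $\mathrm{End}(A)$ spanned by the homogeneous derivations, respectively quasiderivations. The map $\varphi$: one has $\breve g=gt\oplus[g,g]t^2\oplus Ut^2$. For a homogeneous quasiderivation $d$ of $g$ with associated map $d'$ (as in the definition of quasiderivation), $\varphi(d)(at+bt^2+ut^2)=d(a)t+d'(b)t^2$ for $a\in g$, $b\in[g,g]$, $u\in U$; $\varphi$ is extended linearly to $\mathrm{QDer}(g)$. *)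

theory Defs
  imports Complex_Main "HOL-Library.Z2" "HOL-Library.Function_Algebras" "HOL-Library.Product_Plus"
begin

text \<open>
  The degrees are the elements of the field \<^typ>\<open>bit\<close> of integers modulo 2, and
  \<^term>\<open>ksign (a * b)\<close> is the sign usually written (-1)^(ab).
\<close>

definition ksign :: "bit \<Rightarrow> 'k::ring_1" where
  "ksign a = (if a = 1 then - 1 else 1)"

text \<open>
  The data shared by an omega-Lie superalgebra and its extension: scalar multiplication,
  homogeneous parts, bracket and bilinear form. The underlying vector space is the whole type.
\<close>

record ('k, 'v) superalg =
  smul :: "'k \<Rightarrow> 'v \<Rightarrow> 'v"
  part :: "bit \<Rightarrow> 'v set"
  bracket :: "'v \<Rightarrow> 'v \<Rightarrow> 'v"
  form :: "'v \<Rightarrow> 'v \<Rightarrow> 'k"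

definition direct_sum :: "'v::ab_group_add set \<Rightarrow> 'v set \<Rightarrow> bool" where
  "direct_sum V W \<longleftrightarrow> (\<forall>x. \<exists>v\<in>V. \<exists>w\<in>W. x = v + w) \<and> V \<inter> W = {0}"

text \<open>The component in \<open>V\<close> of \<open>x\<close>; meaningful when the space is the direct sum of \<open>V\<close> and \<open>W\<close>.\<close>

definition proj_along :: "'v::ab_group_add set \<Rightarrow> 'v set \<Rightarrow> 'v \<Rightarrow> 'v" where
  "proj_along V W x = (THE v. v \<in> V \<and> x - v \<in> W)"

definition graded_space :: "('k::field, 'v::ab_group_add) superalg \<Rightarrow> bool" where
  "graded_space A \<longleftrightarrow>
     vector_space (smul A) \<and>
     (\<forall>\<alpha>. module.subspace (smul A) (part A \<alpha>)) \<and>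
     direct_sum (part A 0) (part A 1)"

definition omega_Lie_superalgebra :: "('k::field, 'v::ab_group_add) superalg \<Rightarrow> bool" where
  "omega_Lie_superalgebra A \<longleftrightarrow>
     graded_space A \<and>
     (\<forall>x. Vector_Spaces.linear (smul A) (smul A) (\<lambda>y. bracket A x y)) \<and>
     (\<forall>y. Vector_Spaces.linear (smul A) (smul A) (\<lambda>x. bracket A x y)) \<and>
     (\<forall>x. Vector_Spaces.linear (smul A) (*) (\<lambda>y. form A x y)) \<and>
     (\<forall>y. Vector_Spaces.linear (smul A) (*) (\<lambda>x. form A x y)) \<and>
     (\<forall>\<alpha> \<beta>. \<forall>x\<in>part A \<alpha>. \<forall>y\<in>part A \<beta>. bracket A x y \<in> part A (\<alpha> + \<beta>)) \<and>
     (\<forall>\<alpha> \<beta>. \<forall>x\<in>part A \<alpha>. \<forall>y\<in>part A \<beta>.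
        bracket A x y = - smul A (ksign (\<alpha> * \<beta>)) (bracket A y x)) \<and>
     (\<forall>\<alpha> \<beta> \<gamma>. \<forall>x\<in>part A \<alpha>. \<forall>y\<in>part A \<beta>. \<forall>z\<in>part A \<gamma>.
        smul A (ksign (\<alpha> * \<beta>)) (bracket A (bracket A y z) x) +
        smul A (ksign (\<beta> * \<gamma>)) (bracket A (bracket A z x) y) +
        smul A (ksign (\<alpha> * \<gamma>)) (bracket A (bracket A x y) z) =
        smul A (ksign (\<alpha> * \<beta>) * form A y z) x +
        smul A (ksign (\<beta> * \<gamma>) * form A z x) y +
        smul A (ksign (\<alpha> * \<gamma>) * form A x y) z) \<and>
     (\<forall>x\<in>part A 0. \<forall>y\<in>part A 1. form A x y = 0)"

definition derived :: "('k::field, 'v::ab_group_add) superalg \<Rightarrow> 'v set" where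
  "derived A = module.span (smul A) {bracket A x y | x y. True}"

definition graded_subspace :: "('k::field, 'v::ab_group_add) superalg \<Rightarrow> 'v set \<Rightarrow> bool" where
  "graded_subspace A U \<longleftrightarrow>
     module.subspace (smul A) U \<and>
     (\<forall>u\<in>U. \<exists>u0\<in>U \<inter> part A 0. \<exists>u1\<in>U \<inter> part A 1. u = u0 + u1)"

definition homogeneous_map ::
  "('k::field, 'v::ab_group_add) superalg \<Rightarrow> bit \<Rightarrow> ('v \<Rightarrow> 'v) \<Rightarrow> bool" where
  "homogeneous_map A \<delta> d \<longleftrightarrow>
     Vector_Spaces.linear (smul A) (smul A) d \<and> (\<forall>\<alpha>. \<forall>x\<in>part A \<alpha>. d x \<in> part A (\<alpha> + \<delta>))"

definition homogeneous_derivation ::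
  "('k::field, 'v::ab_group_add) superalg \<Rightarrow> bit \<Rightarrow> ('v \<Rightarrow> 'v) \<Rightarrow> bool" where
  "homogeneous_derivation A \<delta> d \<longleftrightarrow>
     homogeneous_map A \<delta> d \<and>
     (\<forall>\<alpha>. \<forall>x\<in>part A \<alpha>. \<forall>y.
        d (bracket A x y) = bracket A (d x) y + smul A (ksign (\<delta> * \<alpha>)) (bracket A x (d y)))"

definition associated_map ::
  "('k::field, 'v::ab_group_add) superalg \<Rightarrow> bit \<Rightarrow> ('v \<Rightarrow> 'v) \<Rightarrow> ('v \<Rightarrow> 'v) \<Rightarrow> bool" where
  "associated_map A \<delta> d d' \<longleftrightarrow>
     homogeneous_map A \<delta> d' \<and>
     (\<forall>\<alpha>. \<forall>x\<in>part A \<alpha>. \<forall>y.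
        d' (bracket A x y) = bracket A (d x) y + smul A (ksign (\<delta> * \<alpha>)) (bracket A x (d y)))"

definition homogeneous_quasiderivation ::
  "('k::field, 'v::ab_group_add) superalg \<Rightarrow> bit \<Rightarrow> ('v \<Rightarrow> 'v) \<Rightarrow> bool" where
  "homogeneous_quasiderivation A \<delta> d \<longleftrightarrow>
     homogeneous_map A \<delta> d \<and> (\<exists>d'. associated_map A \<delta> d d')"

definition end_smul ::
  "('k::field, 'v::ab_group_add) superalg \<Rightarrow> 'k \<Rightarrow> ('v \<Rightarrow> 'v) \<Rightarrow> ('v \<Rightarrow> 'v)" where
  "end_smul A c d = (\<lambda>x. smul A c (d x))"

definition Der :: "('k::field, 'v::ab_group_add) superalg \<Rightarrow> ('v \<Rightarrow> 'v) set" where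
  "Der A = module.span (end_smul A) {d. \<exists>\<delta>. homogeneous_derivation A \<delta> d}"

definition QDer :: "('k::field, 'v::ab_group_add) superalg \<Rightarrow> ('v \<Rightarrow> 'v) set" where
  "QDer A = module.span (end_smul A) {d. \<exists>\<delta>. homogeneous_quasiderivation A \<delta> d}"

definition elem_component ::
  "('k::field, 'v::ab_group_add) superalg \<Rightarrow> bit \<Rightarrow> 'v \<Rightarrow> 'v" where
  "elem_component A \<alpha> = proj_along (part A \<alpha>) (part A (\<alpha> + 1))"

text \<open>
  The degree \<open>\<delta>\<close> component of a linear map; see
  \<open>map_component_homogeneous\<close> and \<open>map_component_unique\<close> below.
\<close>

definition map_component ::
  "('k::field, 'v::ab_group_add) superalg \<Rightarrow> bit \<Rightarrow> ('v \<Rightarrow> 'v) \<Rightarrow> ('v \<Rightarrow> 'v)" where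
  "map_component A \<delta> d =
     (\<lambda>x. elem_component A \<delta> (d (elem_component A 0 x)) +
          elem_component A (1 + \<delta>) (d (elem_component A 1 x)))"

definition homogeneous_compatible ::
  "('k::field, 'v::ab_group_add) superalg \<Rightarrow> bit \<Rightarrow> ('v \<Rightarrow> 'v) \<Rightarrow> bool" where
  "homogeneous_compatible A \<delta> d \<longleftrightarrow>
     homogeneous_map A \<delta> d \<and>
     (\<forall>\<alpha>. \<forall>x\<in>part A \<alpha>. \<forall>y.
        form A (d x) y + ksign (\<delta> * \<alpha>) * form A x (d y) = 0)"

definition compatible :: "('k::field, 'v::ab_group_add) superalg \<Rightarrow> ('v \<Rightarrow> 'v) \<Rightarrow> bool" where
  "compatible A d \<longleftrightarrow>
     Vector_Spaces.linear (smul A) (smul A) d \<and>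
     (\<forall>\<delta>. homogeneous_compatible A \<delta> (map_component A \<delta> d))"

text \<open>The pair \<open>(x, y)\<close> stands for the element \<open>xt + yt\<^sup>2\<close> of \<open>gt \<oplus> gt\<^sup>2\<close>.\<close>

definition breve ::
  "('k::field, 'v::ab_group_add) superalg \<Rightarrow> ('k, 'v \<times> 'v) superalg" where
  "breve A =
     \<lparr>smul = (\<lambda>c (x, y). (smul A c x, smul A c y)),
      part = (\<lambda>\<alpha>. part A \<alpha> \<times> part A \<alpha>),
      bracket = (\<lambda>(x, y) (x', y'). (0, bracket A x x')),
      form = (\<lambda>(x, y) (x', y'). form A x x')\<rparr>"

text \<open>
  The values of an associated map on \<^term>\<open>derived A\<close> are determined by \<open>d\<close> and \<open>\<delta>\<close>, so the choice
  of \<open>d'\<close> in \<open>hom_phi\<close> is immaterial, and \<open>phi\<close> is the linear extension of \<open>hom_phi\<close>; see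
  \<open>phi_homogeneous\<close> and \<open>phi_linear\<close> below.
\<close>

definition hom_phi ::
  "('k::field, 'v::ab_group_add) superalg \<Rightarrow> 'v set \<Rightarrow> bit \<Rightarrow> ('v \<Rightarrow> 'v) \<Rightarrow> ('v \<times> 'v \<Rightarrow> 'v \<times> 'v)"
where
  "hom_phi A U \<delta> d =
     (let d' = (SOME d'. associated_map A \<delta> d d')
      in (\<lambda>(a, y). (d a, d' (proj_along (derived A) U y))))"

definition phi ::
  "('k::field, 'v::ab_group_add) superalg \<Rightarrow> 'v set \<Rightarrow> ('v \<Rightarrow> 'v) \<Rightarrow> ('v \<times> 'v \<Rightarrow> 'v \<times> 'v)" where
  "phi A U d = hom_phi A U 0 (map_component A 0 d) + hom_phi A U 1 (map_component A 1 d)"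

lemma proj_along_eq:
  assumes "vector_space s" and V: "module.subspace s V" and W: "module.subspace s W"
    and "direct_sum V W" and "v \<in> V" and "w \<in> W"
  shows "proj_along V W (v + w) = v"
proof -
  interpret vector_space s by fact
  show ?thesis unfolding proj_along_def
  proof (rule the_equality)
    fix v' assume a: "v' \<in> V \<and> v + w - v' \<in> W"
    have "v - v' = (v + w - v') - w" by simp
    then have "v - v' \<in> W" using a W \<open>w \<in> W\<close> subspace_diff by metis
    moreover have "v - v' \<in> V" using a V \<open>v \<in> V\<close> subspace_diff by blast
    ultimately have "v - v' \<in> {0}" using assms(4) unfolding direct_sum_def by blast
    then show "v' = v" by simp
  qed (use assms in auto)
qed

lemma direct_sum_commute: "direct_sum V W \<Longrightarrow> direct_sum W V"
  unfolding direct_sum_def by (metis Int_commute add.commute)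

lemma elem_component_eq:
  assumes "graded_space A" and "x0 \<in> part A 0" and "x1 \<in> part A 1"
  shows "elem_component A 0 (x0 + x1) = x0" and "elem_component A 1 (x0 + x1) = x1"
proof -
  have g: "vector_space (smul A)" "\<And>\<alpha>. module.subspace (smul A) (part A \<alpha>)"
    "direct_sum (part A 0) (part A 1)"
    using assms(1) unfolding graded_space_def by auto
  show "elem_component A 0 (x0 + x1) = x0"
    using proj_along_eq[OF g(1) g(2) g(2) g(3) assms(2,3)] by (simp add: elem_component_def)
  show "elem_component A 1 (x0 + x1) = x1"
    using proj_along_eq[OF g(1) g(2) g(2) direct_sum_commute[OF g(3)] assms(3,2)]
    by (simp add: elem_component_def add.commute)
qed

lemma graded_space_decompose:
  assumes "graded_space A"
  obtains x0 x1 where "x0 \<in> part A 0" "x1 \<in> part A 1" "x = x0 + x1"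
  using assms unfolding graded_space_def direct_sum_def by meson

lemma map_component_unique:
  assumes g: "graded_space A" and d0: "homogeneous_map A 0 d0" and d1: "homogeneous_map A 1 d1"
  shows "map_component A 0 (d0 + d1) = d0" and "map_component A 1 (d0 + d1) = d1"
proof -
  interpret l0: Vector_Spaces.linear "smul A" "smul A" d0
    using d0 by (simp add: homogeneous_map_def)
  interpret l1: Vector_Spaces.linear "smul A" "smul A" d1
    using d1 by (simp add: homogeneous_map_def)
  have m: "d0 x0 \<in> part A 0" "d0 x1 \<in> part A 1" "d1 x0 \<in> part A 1" "d1 x1 \<in> part A 0"
    if "x0 \<in> part A 0" "x1 \<in> part A 1" for x0 x1
  proof -
    have h0: "\<And>\<alpha> x. x \<in> part A \<alpha> \<Longrightarrow> d0 x \<in> part A (\<alpha> + 0)"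
      and h1: "\<And>\<alpha> x. x \<in> part A \<alpha> \<Longrightarrow> d1 x \<in> part A (\<alpha> + 1)"
      using d0 d1 unfolding homogeneous_map_def by blast+
    show "d0 x0 \<in> part A 0" "d0 x1 \<in> part A 1" "d1 x0 \<in> part A 1" "d1 x1 \<in> part A 0"
      using h0[OF that(1)] h0[OF that(2)] h1[OF that(1)] h1[OF that(2)] by simp_all
  qed
  have "map_component A 0 (d0 + d1) x = d0 x \<and> map_component A 1 (d0 + d1) x = d1 x" for x
  proof -
    obtain x0 x1 where x: "x0 \<in> part A 0" "x1 \<in> part A 1" "x = x0 + x1"
      using graded_space_decompose[OF g] by blast
    note n = m[OF x(1,2)]
    show ?thesis
      using elem_component_eq[OF g n(1,3)] elem_component_eq[OF g n(4,2)]
        elem_component_eq[OF g x(1,2)]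
      by (simp add: map_component_def x(3) l0.add l1.add add.commute)
  qed
  then show "map_component A 0 (d0 + d1) = d0" and "map_component A 1 (d0 + d1) = d1" by auto
qed

lemma associated_map_determined:
  assumes "graded_space A" and "associated_map A \<delta> d d'" and "associated_map A \<delta> d d''"
    and "\<And>y. Vector_Spaces.linear (smul A) (smul A) (\<lambda>x. bracket A x y)"
    and "b \<in> derived A"
  shows "d' b = d'' b"
proof -
  interpret l: Vector_Spaces.linear "smul A" "smul A" d'
    using assms(2) by (simp add: associated_map_def homogeneous_map_def)
  interpret l': Vector_Spaces.linear "smul A" "smul A" d''
    using assms(3) by (simp add: associated_map_def homogeneous_map_def)
  interpret vector_space_pair "smul A" "smul A" ..
  have eq: "d' (bracket A x y) = d'' (bracket A x y)" for x y
  proof -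
    obtain x0 x1 where x: "x0 \<in> part A 0" "x1 \<in> part A 1" "x = x0 + x1"
      using graded_space_decompose[OF assms(1)] by blast
    have h: "d' (bracket A z y) = d'' (bracket A z y)" if "z \<in> part A \<alpha>" for z \<alpha>
      using assms(2,3) that unfolding associated_map_def by simp
    have "bracket A x y = bracket A x0 y + bracket A x1 y"
      using assms(4) unfolding x(3) by (rule Vector_Spaces.linear.axioms(3)[THEN module_hom.add])
    then show ?thesis using h[OF x(1)] h[OF x(2)] by (simp add: l.add l'.add)
  qed
  show ?thesis
    using linear_eq_on[OF l.linear_axioms l'.linear_axioms assms(5)[unfolded derived_def]] eq by auto
qed

lemma hom_phi_eq:
  assumes "omega_Lie_superalgebra A" and U: "graded_subspace A U" "direct_sum (derived A) U"
    and d': "associated_map A \<delta> d d'" and b: "b \<in> derived A" and u: "u \<in> U"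
  shows "hom_phi A U \<delta> d (a, b + u) = (d a, d' b)"
proof -
  have g: "graded_space A" "vector_space (smul A)"
    and br: "\<And>y. Vector_Spaces.linear (smul A) (smul A) (\<lambda>x. bracket A x y)"
    using assms(1) by (auto simp: omega_Lie_superalgebra_def graded_space_def)
  interpret vector_space "smul A" by fact
  have p: "proj_along (derived A) U (b + u) = b"
    using proj_along_eq[OF g(2) _ _ U(2) b u] U(1) by (simp add: derived_def graded_subspace_def)
  have "associated_map A \<delta> d (SOME d'. associated_map A \<delta> d d')" by (rule someI[of _ d']) fact
  from associated_map_determined[OF g(1) this d' br b] show ?thesis
    by (simp add: hom_phi_def Let_def p)
qed

lemma vector_space_end_smul: "vector_space (smul A) \<Longrightarrow> vector_space (end_smul A)"
  by (simp add: vector_space_def end_smul_def fun_eq_iff)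

lemma homogeneous_map_subspace:
  assumes "graded_space A"
  shows "module.subspace (end_smul A) {d. homogeneous_map A \<delta> d}"
proof -
  have v: "vector_space (smul A)" and p: "\<And>\<alpha>. module.subspace (smul A) (part A \<alpha>)"
    using assms by (auto simp: graded_space_def)
  interpret vector_space "smul A" by fact
  interpret E: vector_space "end_smul A" by (rule vector_space_end_smul) fact
  show ?thesis
    unfolding E.subspace_def homogeneous_map_def Vector_Spaces.linear_iff
    using p v by (auto simp: end_smul_def subspace_0 subspace_add subspace_scale
        scale_right_distrib scale_left_commute)
qed

lemma associated_map_linear:
  assumes "omega_Lie_superalgebra A"
  shows "associated_map A \<delta> 0 0"
    and "associated_map A \<delta> d d' \<Longrightarrow> associated_map A \<delta> e e' \<Longrightarrow> associated_map A \<delta> (d + e) (d' + e')"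
    and "associated_map A \<delta> d d' \<Longrightarrow> associated_map A \<delta> (end_smul A c d) (end_smul A c d')"
proof -
  have g: "graded_space A" and v: "vector_space (smul A)"
    and br1: "\<And>y. Vector_Spaces.linear (smul A) (smul A) (\<lambda>x. bracket A x y)"
    and br2: "\<And>x. Vector_Spaces.linear (smul A) (smul A) (\<lambda>y. bracket A x y)"
    using assms by (auto simp: omega_Lie_superalgebra_def graded_space_def)
  interpret vector_space "smul A" by fact
  interpret E: vector_space "end_smul A" by (rule vector_space_end_smul) fact
  note S = homogeneous_map_subspace[OF g, of \<delta>, unfolded E.subspace_def, simplified]
  have b: "bracket A (x + x') y = bracket A x y + bracket A x' y"
    "bracket A x (y + y') = bracket A x y + bracket A x y'"
    "bracket A (smul A c x) y = smul A c (bracket A x y)"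
    "bracket A x (smul A c y) = smul A c (bracket A x y)"
    "bracket A 0 y = 0" "bracket A x 0 = 0" for x x' y y' c
    using br1[of y] br2[of x] unfolding Vector_Spaces.linear_iff
    by (auto intro: module_hom.zero[OF Vector_Spaces.linear.axioms(3)[OF br1]]
        module_hom.zero[OF Vector_Spaces.linear.axioms(3)[OF br2]])
  show "associated_map A \<delta> 0 0"
    using S unfolding associated_map_def by (auto simp: b)
  show "associated_map A \<delta> (d + e) (d' + e')"
    if "associated_map A \<delta> d d'" "associated_map A \<delta> e e'"
    using S that unfolding associated_map_def by (auto simp: b scale_right_distrib)
  show "associated_map A \<delta> (end_smul A c d) (end_smul A c d')" if "associated_map A \<delta> d d'"
    using S that unfolding associated_map_def
    by (auto simp: b end_smul_def scale_right_distrib scale_left_commute)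
qed

lemma homogeneous_quasiderivation_subspace:
  assumes "omega_Lie_superalgebra A"
  shows "module.subspace (end_smul A) {d. homogeneous_quasiderivation A \<delta> d}"
proof -
  have g: "graded_space A" and v: "vector_space (smul A)"
    using assms by (auto simp: omega_Lie_superalgebra_def graded_space_def)
  interpret E: vector_space "end_smul A" by (rule vector_space_end_smul) fact
  show ?thesis
    using associated_map_linear[OF assms, of \<delta>]
      homogeneous_map_subspace[OF g, of \<delta>, unfolded E.subspace_def]
    unfolding E.subspace_def homogeneous_quasiderivation_def by (simp; meson)
qed

lemma QDer_decompose:
  assumes A: "omega_Lie_superalgebra A" and d: "d \<in> QDer A"
  obtains d0 d1 where "homogeneous_quasiderivation A 0 d0" "homogeneous_quasiderivation A 1 d1"
    "d = d0 + d1"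
proof -
  have v: "vector_space (smul A)"
    using A by (auto simp: omega_Lie_superalgebra_def graded_space_def)
  interpret E: vector_space "end_smul A" by (rule vector_space_end_smul) fact
  let ?H = "\<lambda>\<delta>. {d. homogeneous_quasiderivation A \<delta> d}"
  note H = homogeneous_quasiderivation_subspace[OF A]
  have "d \<in> {d0 + d1 | d0 d1. d0 \<in> ?H 0 \<and> d1 \<in> ?H 1}"
  proof (rule subsetD[OF E.span_minimal d[unfolded QDer_def]])
    show "E.subspace {d0 + d1 | d0 d1. d0 \<in> ?H 0 \<and> d1 \<in> ?H 1}"
      using E.subspace_sums[OF H H] .
    show "{d. \<exists>\<delta>. homogeneous_quasiderivation A \<delta> d} \<subseteq> {d0 + d1 | d0 d1. d0 \<in> ?H 0 \<and> d1 \<in> ?H 1}"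
    proof clarify
      fix d \<delta> assume d: "homogeneous_quasiderivation A \<delta> d"
      have "0 \<in> ?H \<epsilon>" for \<epsilon> using H E.subspace_0 by blast
      then show "\<exists>d0 d1. d = d0 + d1 \<and> d0 \<in> ?H 0 \<and> d1 \<in> ?H 1"
        using d by (cases \<delta>)
          (auto intro: exI[of _ d] exI[of _ "0 :: 'b \<Rightarrow> 'b"])
    qed
  qed
  then show ?thesis using that by blast
qed

lemma phi_sum:
  assumes A: "omega_Lie_superalgebra A" and U: "graded_subspace A U" "direct_sum (derived A) U"
    and d: "homogeneous_map A 0 d0" "homogeneous_map A 1 d1"
    and d': "associated_map A 0 d0 d0'" "associated_map A 1 d1 d1'"
    and b: "b \<in> derived A" and u: "u \<in> U"
  shows "phi A U (d0 + d1) (a, b + u) = (d0 a + d1 a, d0' b + d1' b)"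
proof -
  have g: "graded_space A" using A by (simp add: omega_Lie_superalgebra_def)
  show ?thesis
    unfolding phi_def map_component_unique[OF g d]
    by (simp add: hom_phi_eq[OF A U d'(1) b u] hom_phi_eq[OF A U d'(2) b u])
qed

lemma phi_homogeneous:
  assumes A: "omega_Lie_superalgebra A" and U: "graded_subspace A U" "direct_sum (derived A) U"
    and d: "homogeneous_map A \<delta> d" and d': "associated_map A \<delta> d d'"
    and b: "b \<in> derived A" and u: "u \<in> U"
  shows "phi A U d (a, b + u) = (d a, d' b)"
proof -
  note z' = associated_map_linear(1)[OF A]
  have z: "\<And>\<delta>. homogeneous_map A \<delta> 0"
    using z' by (simp add: associated_map_def)
  consider "\<delta> = 0" | "\<delta> = 1" by (cases \<delta>)
  then show ?thesis
  proof cases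
    case 1
    then show ?thesis
      using phi_sum[OF A U _ z _ z' b u, of d d' a] d d' by simp
  next
    case 2
    then show ?thesis
      using phi_sum[OF A U z _ z' _ b u, of d d' a] d d' by simp
  qed
qed

lemma phi_linear:
  fixes A :: "('k::field, 'v::ab_group_add) superalg"
  assumes A: "omega_Lie_superalgebra A" and U: "graded_subspace A U" "direct_sum (derived A) U"
    and d: "d \<in> QDer A"
  shows "e \<in> QDer A \<Longrightarrow> phi A U (d + e) = phi A U d + phi A U e"
    and "phi A U (end_smul A c d) = end_smul (breve A) c (phi A U d)"
proof -
  have g: "graded_space A" and v: "vector_space (smul A)"
    using A by (auto simp: omega_Lie_superalgebra_def graded_space_def)
  interpret vector_space "smul A" by fact
  note S = associated_map_linear[OF A]
  interpret E: vector_space "end_smul A" by (rule vector_space_end_smul) fact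
  note H = homogeneous_map_subspace[OF g, unfolded E.subspace_def, simplified]
  obtain d0 d1 where d01: "homogeneous_map A 0 d0" "homogeneous_map A 1 d1" "d = d0 + d1"
    and "\<exists>d'. associated_map A 0 d0 d'" "\<exists>d'. associated_map A 1 d1 d'"
    using QDer_decompose[OF A d] by (metis homogeneous_quasiderivation_def)
  then obtain d0' d1' where d': "associated_map A 0 d0 d0'" "associated_map A 1 d1 d1'" by blast
  show "phi A U (d + e) = phi A U d + phi A U e" if e: "e \<in> QDer A"
  proof
    fix X :: "'v \<times> 'v"
    obtain a b u where X: "X = (a, b + u)" and b: "b \<in> derived A" and u: "u \<in> U"
      using U(2) unfolding direct_sum_def by (metis surj_pair)
    obtain e0 e1 where e01: "homogeneous_map A 0 e0" "homogeneous_map A 1 e1" "e = e0 + e1"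
      and "\<exists>d'. associated_map A 0 e0 d'" "\<exists>d'. associated_map A 1 e1 d'"
      using QDer_decompose[OF A e] by (metis homogeneous_quasiderivation_def)
    then obtain e0' e1' where e': "associated_map A 0 e0 e0'" "associated_map A 1 e1 e1'" by blast
    have de: "d + e = (d0 + e0) + (d1 + e1)" using d01 e01 by (simp add: algebra_simps)
    have "phi A U (d + e) X = ((d0 + e0) a + (d1 + e1) a, (d0' + e0') b + (d1' + e1') b)"
      unfolding de X using H d01 e01
      by (intro phi_sum[OF A U _ _ S(2)[OF d'(1) e'(1)] S(2)[OF d'(2) e'(2)] b u]) blast+
    also have "\<dots> = (phi A U d + phi A U e) X"
      using phi_sum[OF A U d01(1,2) d' b u] phi_sum[OF A U e01(1,2) e' b u] d01(3) e01(3)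
      by (simp add: X algebra_simps)
    finally show "phi A U (d + e) X = (phi A U d + phi A U e) X" .
  qed
  show "phi A U (end_smul A c d) = end_smul (breve A) c (phi A U d)"
  proof
    fix X :: "'v \<times> 'v"
    obtain a b u where X: "X = (a, b + u)" and b: "b \<in> derived A" and u: "u \<in> U"
      using U(2) unfolding direct_sum_def by (metis surj_pair)
    have de: "end_smul A c d = end_smul A c d0 + end_smul A c d1"
      unfolding d01(3) by (rule E.scale_right_distrib)
    have "phi A U (end_smul A c d) X = (end_smul A c d0 a + end_smul A c d1 a,
        end_smul A c d0' b + end_smul A c d1' b)"
      unfolding de X using H d01
      by (intro phi_sum[OF A U _ _ S(3)[OF d'(1)] S(3)[OF d'(2)] b u]) blast+
    also have "\<dots> = end_smul (breve A) c (phi A U d) X"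
      using phi_sum[OF A U d01(1,2) d' b u] d01(3)
      by (simp add: X end_smul_def breve_def scale_right_distrib)
    finally show "phi A U (end_smul A c d) X = end_smul (breve A) c (phi A U d) X" .
  qed
qed

lemma map_component_homogeneous:
  assumes g: "graded_space A" and "Vector_Spaces.linear (smul A) (smul A) d"
  shows "homogeneous_map A \<delta> (map_component A \<delta> d)"
    and "map_component A 0 d + map_component A 1 d = d"
proof -
  have p: "\<And>\<alpha>. module.subspace (smul A) (part A \<alpha>)"
    using g by (auto simp: graded_space_def)
  interpret l: Vector_Spaces.linear "smul A" "smul A" d by fact
  have e: "elem_component A \<alpha> x \<in> part A \<alpha>" "elem_component A 0 x + elem_component A 1 x = x"
    "elem_component A \<alpha> (x + y) = elem_component A \<alpha> x + elem_component A \<alpha> y"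
    "elem_component A \<alpha> (smul A c x) = smul A c (elem_component A \<alpha> x)" for \<alpha> x y c
  proof -
    obtain x0 x1 where x: "x0 \<in> part A 0" "x1 \<in> part A 1" "x = x0 + x1"
      using graded_space_decompose[OF g] by blast
    obtain y0 y1 where y: "y0 \<in> part A 0" "y1 \<in> part A 1" "y = y0 + y1"
      using graded_space_decompose[OF g] by blast
    have xy: "x + y = (x0 + y0) + (x1 + y1)" by (simp add: x y)
    have cx: "smul A c x = smul A c x0 + smul A c x1" by (simp add: x l.vs1.scale_right_distrib)
    note E = elem_component_eq[OF g x(1,2)] elem_component_eq[OF g y(1,2)]
      elem_component_eq[OF g l.vs1.subspace_add[OF p x(1) y(1)] l.vs1.subspace_add[OF p x(2) y(2)]]
      elem_component_eq[OF g l.vs1.subspace_scale[OF p x(1)] l.vs1.subspace_scale[OF p x(2)]]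
    consider "\<alpha> = 0" | "\<alpha> = 1" by (cases \<alpha>)
    note C = this
    from C show "elem_component A \<alpha> x \<in> part A \<alpha>"
      by cases (simp_all only: x(3) E(1,2) x(1,2))
    show "elem_component A 0 x + elem_component A 1 x = x"
      by (simp only: x(3) E(1,2))
    from C show "elem_component A \<alpha> (x + y) = elem_component A \<alpha> x + elem_component A \<alpha> y"
      unfolding xy by cases (simp_all only: x(3) y(3) E)
    from C show "elem_component A \<alpha> (smul A c x) = smul A c (elem_component A \<alpha> x)"
      unfolding cx by cases (simp_all only: x(3) E)
  qed
  have z: "elem_component A \<alpha> 0 = 0" for \<alpha> using e(4)[of \<alpha> 0 0] by simp
  have h: "elem_component A \<beta> x = (if \<alpha> = \<beta> then x else 0)" if "x \<in> part A \<alpha>" for \<alpha> \<beta> x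
    using elem_component_eq[OF g, of x 0] elem_component_eq[OF g, of 0 x] that l.vs1.subspace_0[OF p]
    by (cases \<alpha>; cases \<beta>) auto
  show "homogeneous_map A \<delta> (map_component A \<delta> d)"
    unfolding homogeneous_map_def
  proof (intro conjI allI ballI)
    show "Vector_Spaces.linear (smul A) (smul A) (map_component A \<delta> d)"
      using l.vs1.vector_space_axioms
      by (auto simp: Vector_Spaces.linear_iff map_component_def e(3,4) l.add l.scale
          l.vs1.scale_right_distrib)
    fix \<alpha> x assume "x \<in> part A \<alpha>"
    then show "map_component A \<delta> d x \<in> part A (\<alpha> + \<delta>)"
      using e(1)[of \<delta>] e(1)[of "1+\<delta>"]
      by (cases \<alpha>) (auto simp del: add_bit_eq_xor simp: map_component_def h z)
  qed
  show "map_component A 0 d + map_component A 1 d = d"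
  proof
    fix x
    have "(map_component A 0 d + map_component A 1 d) x =
      (elem_component A 0 (d (elem_component A 0 x)) + elem_component A 1 (d (elem_component A 0 x))) +
      (elem_component A 0 (d (elem_component A 1 x)) + elem_component A 1 (d (elem_component A 1 x)))"
      by (simp add: map_component_def)
    also have "\<dots> = d x" unfolding e(2) l.add[symmetric] by (rule refl)
    finally show "(map_component A 0 d + map_component A 1 d) x = d x" .
  qed
qed

end

theory Submission
  imports Defs
begin

text \<open>
  All brackets of \<open>gt \<oplus> gt\<^sup>2\<close> lie in \<open>[g, g]t\<^sup>2\<close>, where the image of \<open>d\<close> acts as \<open>d'\<close>, so the Leibniz rule
  there is the defining identity of the quasiderivation \<open>d\<close>. The image is homogeneous because the
  derived algebra is spanned by brackets of homogeneous elements, hence graded. Compatibility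
  transfers since the form sees only the \<open>gt\<close>-components, on which the image of \<open>d\<close> is \<open>d\<close>.
\<close>

lemma breve_simps [simp]:
  "smul (breve A) c (x, y) = (smul A c x, smul A c y)"
  "part (breve A) \<alpha> = part A \<alpha> \<times> part A \<alpha>"
  "bracket (breve A) (x, y) (x', y') = (0, bracket A x x')"
  "form (breve A) (x, y) (x', y') = form A x x'"
  by (simp_all add: breve_def)

text \<open>Makes the splitting of a linear map of \<open>breve A\<close> into an even and an odd
  component meaningful and unique, as the notion \<open>compatible (breve A)\<close>
  requires.\<close>

lemma graded_space_breve:
  assumes "graded_space A"
  shows "graded_space (breve A)"
proof -
  interpret vector_space "smul A" using assms by (simp add: graded_space_def)
  have p: "subspace (part A \<alpha>)" for \<alpha> using assms by (simp add: graded_space_def)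
  interpret B: vector_space "smul (breve A)"
    by unfold_locales (auto simp: scale_right_distrib scale_left_distrib)
  have "\<exists>v\<in>part (breve A) 0. \<exists>w\<in>part (breve A) 1. X = v + w" for X
  proof -
    obtain x y where X: "X = (x, y)" by fastforce
    obtain x0 x1 y0 y1 where "x0 \<in> part A 0" "x1 \<in> part A 1" "x = x0 + x1"
      "y0 \<in> part A 0" "y1 \<in> part A 1" "y = y0 + y1"
      using graded_space_decompose[OF assms] by metis
    then show ?thesis
      by (intro bexI[of _ "(x0, y0)"] bexI[of _ "(x1, y1)"]) (auto simp: X)
  qed
  moreover have "part (breve A) 0 \<inter> part (breve A) 1 = {0}"
    using assms by (auto simp: graded_space_def direct_sum_def zero_prod_def)
  moreover have "B.subspace (part (breve A) \<alpha>)" for \<alpha>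
    using p[of \<alpha>] unfolding subspace_def B.subspace_def by (auto simp: zero_prod_def)
  ultimately show ?thesis
    unfolding graded_space_def direct_sum_def using B.vector_space_axioms by blast
qed

text \<open>Bilinearity expands any bracket into four brackets of homogeneous elements, each of them
  homogeneous and in \<open>derived A\<close>. Hence every generator lies in the sum of the two
  homogeneous parts of \<open>derived A\<close>; this sum is a subspace, so it contains the whole
  span.\<close>

lemma graded_subspace_derived:
  assumes A: "omega_Lie_superalgebra A"
  shows "graded_subspace A (derived A)"
proof -
  have g: "graded_space A" using A by (simp add: omega_Lie_superalgebra_def)
  interpret vector_space "smul A" using g by (simp add: graded_space_def)
  have p: "subspace (part A \<alpha>)" for \<alpha> using g by (simp add: graded_space_def)
  have D: "subspace (derived A)" by (simp add: derived_def)
  have DP: "subspace (derived A \<inter> part A \<alpha>)" for \<alpha>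
    using subspace_inter[OF D p] .
  have br: "bracket A x y \<in> derived A" for x y
    unfolding derived_def by (rule span_base) blast
  let ?S = "{x + y | x y. x \<in> derived A \<inter> part A 0 \<and> y \<in> derived A \<inter> part A 1}"
  have S: "subspace ?S" using subspace_sums[OF DP DP] .
  have "bracket A x y \<in> ?S" for x y
  proof -
    obtain x0 x1 where x: "x0 \<in> part A 0" "x1 \<in> part A 1" "x = x0 + x1"
      using graded_space_decompose[OF g] by blast
    obtain y0 y1 where y: "y0 \<in> part A 0" "y1 \<in> part A 1" "y = y0 + y1"
      using graded_space_decompose[OF g] by blast
    have c: "bracket A v w \<in> part A (\<alpha> + \<beta>)" if "v \<in> part A \<alpha>" "w \<in> part A \<beta>" for v w \<alpha> \<beta>
      using A that unfolding omega_Lie_superalgebra_def by blast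
    have "Vector_Spaces.linear (smul A) (smul A) (\<lambda>v. bracket A v w)"
      and "Vector_Spaces.linear (smul A) (smul A) (\<lambda>w. bracket A v w)" for v w
      using A unfolding omega_Lie_superalgebra_def by blast+
    then have add: "bracket A (v + v') w = bracket A v w + bracket A v' w"
      "bracket A v (w + w') = bracket A v w + bracket A v w'" for v v' w w'
      by (simp_all add: Vector_Spaces.linear_iff)
    \<comment> \<open>The four terms are grouped by total degree: since 1 + 1 = 0 among the degrees,
      the bracket of the two odd components joins the even group.\<close>
    have "bracket A x y = (bracket A x0 y0 + bracket A x1 y1) + (bracket A x0 y1 + bracket A x1 y0)"
      by (simp add: x(3) y(3) add algebra_simps)
    moreover have "bracket A x0 y0 + bracket A x1 y1 \<in> derived A \<inter> part A 0"
      using c[OF x(1) y(1)] c[OF x(2) y(2)] br by (intro subspace_add[OF DP]) simp_all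
    moreover have "bracket A x0 y1 + bracket A x1 y0 \<in> derived A \<inter> part A 1"
      using c[OF x(1) y(2)] c[OF x(2) y(1)] br by (intro subspace_add[OF DP]) simp_all
    ultimately show ?thesis by blast
  qed
  then have "derived A \<subseteq> ?S"
    unfolding derived_def[of A] by (intro span_minimal[OF _ S[unfolded derived_def]]) auto
  then show ?thesis using D unfolding graded_subspace_def by blast
qed

text \<open>Split both summands of \<open>x\<close> into homogeneous components. Those of the wrong
  degree add up to an element that is also a difference of elements of degree \<alpha>, so it lies
  in both parts and vanishes. What remains is a decomposition within degree \<alpha>. This is what
  makes \<open>phi\<close> respect degrees.\<close>

lemma graded_complement_part_decompose:
  assumes g: "graded_space A" and V: "graded_subspace A V" and W: "graded_subspace A W"
    and VW: "direct_sum V W" and x: "x \<in> part A \<alpha>"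
  obtains v w where "v \<in> V \<inter> part A \<alpha>" "w \<in> W \<inter> part A \<alpha>" "x = v + w"
proof -
  interpret vector_space "smul A" using g by (simp add: graded_space_def)
  have p: "subspace (part A \<beta>)" for \<beta> using g by (simp add: graded_space_def)
  have sV: "subspace V" and sW: "subspace W"
    using V W by (auto simp: graded_subspace_def)
  have d: "part A 0 \<inter> part A 1 = {0}"
    using g by (simp add: graded_space_def direct_sum_def)
  have dVW: "V \<inter> W = {0}" using VW by (simp add: direct_sum_def)
  obtain v w where "v \<in> V" "w \<in> W" and xvw: "x = v + w"
    using VW unfolding direct_sum_def by blast
  then obtain v0 v1 w0 w1 where
    v: "v0 \<in> V" "v0 \<in> part A 0" "v1 \<in> V" "v1 \<in> part A 1" "v = v0 + v1" and
    w: "w0 \<in> W" "w0 \<in> part A 0" "w1 \<in> W" "w1 \<in> part A 1" "w = w0 + w1"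
    using V W unfolding graded_subspace_def by blast
  have m0: "v0 + w0 \<in> part A 0" and m1: "v1 + w1 \<in> part A 1"
    using subspace_add[OF p] v w by auto
  have e: "x = (v0 + w0) + (v1 + w1)" by (simp add: xvw v(5) w(5) algebra_simps)
  have cancel: "v' = 0 \<and> w' = 0" if "v' \<in> V" "w' \<in> W" "v' + w' = 0" for v' w'
  proof -
    have "v' = - w'" using that(3) by (simp add: add_eq_0_iff2)
    then have "v' \<in> V \<inter> W" using that subspace_neg[OF sW] by auto
    then show ?thesis using dVW that(3) by simp
  qed
  consider "\<alpha> = 0" | "\<alpha> = 1" by (cases \<alpha>)
  then show ?thesis
  proof cases
    case 1
    have "v1 + w1 = x - (v0 + w0)" using e by (simp add: algebra_simps)
    then have "v1 + w1 \<in> part A 0" using subspace_diff[OF p] x m0 1 by metis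
    then have "v1 + w1 = 0" using m1 d by blast
    then show ?thesis using that[of v0 w0] v w e 1 by simp
  next
    case 2
    have "v0 + w0 = x - (v1 + w1)" using e by (simp add: algebra_simps)
    then have "v0 + w0 \<in> part A 1" using subspace_diff[OF p] x m1 2 by metis
    then have "v0 + w0 = 0" using m0 d by blast
    then show ?thesis using that[of v1 w1] v w e 2 by simp
  qed
qed

lemma phi_homogeneous_derivation:
  fixes A :: "('k::field, 'v::ab_group_add) superalg"
  assumes A: "omega_Lie_superalgebra A" and U: "graded_subspace A U" "direct_sum (derived A) U"
    and d: "homogeneous_quasiderivation A \<delta> d"
  shows "homogeneous_derivation (breve A) \<delta> (phi A U d)"
proof -
  have g: "graded_space A" using A by (simp add: omega_Lie_superalgebra_def)
  interpret vector_space "smul A" using g by (simp add: graded_space_def)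
  interpret B: vector_space "smul (breve A)"
    using graded_space_breve[OF g] by (simp add: graded_space_def)
  obtain d' where hd: "homogeneous_map A \<delta> d" and d': "associated_map A \<delta> d d'"
    using d unfolding homogeneous_quasiderivation_def by blast
  have hd': "homogeneous_map A \<delta> d'" using d' by (simp add: associated_map_def)
  interpret l: Vector_Spaces.linear "smul A" "smul A" d
    using hd by (simp add: homogeneous_map_def)
  interpret l': Vector_Spaces.linear "smul A" "smul A" d'
    using hd' by (simp add: homogeneous_map_def)
  have D: "subspace (derived A)" by (simp add: derived_def)
  have sU: "subspace U" using U(1) by (simp add: graded_subspace_def)
  \<comment> \<open>On \<open>(a, b + u)\<close> the map is \<open>(d a, d' b)\<close>, for
    whichever such presentation is at hand. Linearity, degree and Leibniz rule are all checked by
    choosing a suitable presentation of the argument.\<close>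
  note phi = phi_homogeneous[OF A U hd d']
  have decomp: "\<exists>a b u. b \<in> derived A \<and> u \<in> U \<and> X = (a, b + u)" for X :: "'v \<times> 'v"
    using U(2) unfolding direct_sum_def by (metis surj_pair)
  have lin: "Vector_Spaces.linear (smul (breve A)) (smul (breve A)) (phi A U d)"
    unfolding Vector_Spaces.linear_iff
  proof (intro conjI allI B.vector_space_axioms)
    fix X Y :: "'v \<times> 'v"
    obtain a b u where X: "X = (a, b + u)" and bu: "b \<in> derived A" "u \<in> U"
      using decomp by blast
    obtain a' b' u' where Y: "Y = (a', b' + u')" and bu': "b' \<in> derived A" "u' \<in> U"
      using decomp by blast
    \<comment> \<open>Presentations add componentwise because \<open>derived A\<close> and
      \<open>U\<close> are subspaces, so \<open>phi\<close> can be evaluated on the sum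
      directly.\<close>
    have XY: "X + Y = (a + a', (b + b') + (u + u'))" by (simp add: X Y algebra_simps)
    have "phi A U d (X + Y) = (d (a + a'), d' (b + b'))"
      unfolding XY by (intro phi subspace_add[OF D] subspace_add[OF sU] bu bu')
    then show "phi A U d (X + Y) = phi A U d X + phi A U d Y"
      by (simp only: X Y phi[OF bu] phi[OF bu'] l.add l'.add add_Pair)
  next
    fix c and X :: "'v \<times> 'v"
    obtain a b u where X: "X = (a, b + u)" and bu: "b \<in> derived A" "u \<in> U"
      using decomp by blast
    have cX: "smul (breve A) c X = (smul A c a, smul A c b + smul A c u)"
      by (simp add: X scale_right_distrib)
    have "phi A U d (smul (breve A) c X) = (d (smul A c a), d' (smul A c b))"
      unfolding cX by (intro phi subspace_scale[OF D] subspace_scale[OF sU] bu)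
    then show "phi A U d (smul (breve A) c X) = smul (breve A) c (phi A U d X)"
      by (simp only: X phi[OF bu] l.scale l'.scale breve_simps)
  qed
  have deg: "phi A U d X \<in> part (breve A) (\<alpha> + \<delta>)" if Xp: "X \<in> part (breve A) \<alpha>" for X \<alpha>
  proof -
    obtain a x where X: "X = (a, x)" and a: "a \<in> part A \<alpha>" and x: "x \<in> part A \<alpha>"
      using Xp by auto
    \<comment> \<open>An arbitrary presentation would not do here: \<open>b\<close> must itself have
      degree \<alpha> for the homogeneity of \<open>d'\<close> to locate
      \<open>d' b\<close>.\<close>
    obtain b u where "b \<in> derived A \<inter> part A \<alpha>" "u \<in> U \<inter> part A \<alpha>" "x = b + u"
      using graded_complement_part_decompose[OF g graded_subspace_derived[OF A] U x] by blast
    then show ?thesis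
      using phi[of b u a] hd hd' a
      by (simp add: X homogeneous_map_def del: add_bit_eq_xor)
  qed
  have leib: "phi A U d (bracket (breve A) X Y) = bracket (breve A) (phi A U d X) Y +
      smul (breve A) (ksign (\<delta> * \<alpha>)) (bracket (breve A) X (phi A U d Y))"
    if "X \<in> part (breve A) \<alpha>" for X Y \<alpha>
  proof -
    obtain a b u where X: "X = (a, b + u)" and bu: "b \<in> derived A" "u \<in> U"
      using decomp by blast
    obtain a' b' u' where Y: "Y = (a', b' + u')" and bu': "b' \<in> derived A" "u' \<in> U"
      using decomp by blast
    have br: "bracket A a a' \<in> derived A" unfolding derived_def by (rule span_base) blast
    have "a \<in> part A \<alpha>" using that X by simp
    then have "d' (bracket A a a') = bracket A (d a) a' + smul A (ksign (\<delta> * \<alpha>)) (bracket A a (d a'))"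
      using d' unfolding associated_map_def by blast
    \<comment> \<open>The bracket of \<open>X\<close> and \<open>Y\<close> is
      \<open>(0, bracket A a a')\<close>, presented with zero \<open>U\<close>-component, so its
      image is \<open>(d 0, d' (bracket A a a'))\<close>. The right-hand side sees only the first
      components \<open>d a\<close> and \<open>d a'\<close> of the images of \<open>X\<close> and
      \<open>Y\<close>.\<close>
    then show ?thesis
      using phi[OF bu] phi[OF bu'] phi[OF br subspace_0[OF sU], of 0]
      by (simp add: X Y l.zero)
  qed
  show ?thesis
    unfolding homogeneous_derivation_def homogeneous_map_def using lin deg leib by blast
qed

text \<open>The first component of \<open>phi A U d (a, x)\<close> is \<open>d a\<close> for every
  \<open>x\<close>, so both compatibility conditions are the same identity between values of
  \<open>form A\<close>.\<close>

lemma phi_homogeneous_compatible_iff: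
  assumes A: "omega_Lie_superalgebra A" and U: "graded_subspace A U" "direct_sum (derived A) U"
    and d: "homogeneous_quasiderivation A \<delta> d"
  shows "homogeneous_compatible (breve A) \<delta> (phi A U d) \<longleftrightarrow> homogeneous_compatible A \<delta> d"
proof -
  have g: "graded_space A" using A by (simp add: omega_Lie_superalgebra_def)
  interpret vector_space "smul A" using g by (simp add: graded_space_def)
  \<comment> \<open>Ensures that \<open>(x, 0)\<close> is homogeneous of the same degree as
    \<open>x\<close>; testing on such pairs recovers the condition on \<open>d\<close> from the one
    on its image.\<close>
  have z: "0 \<in> part A \<alpha>" for \<alpha> using g subspace_0 by (auto simp: graded_space_def)
  obtain d' where hd: "homogeneous_map A \<delta> d" and d': "associated_map A \<delta> d d'"
    using d unfolding homogeneous_quasiderivation_def by blast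
  have "\<exists>b u. b \<in> derived A \<and> u \<in> U \<and> x = b + u" for x
    using U(2) unfolding direct_sum_def by blast
  then have "\<exists>y. phi A U d (a, x) = (d a, y)" for a x
    using phi_homogeneous[OF A U hd d'] by metis
  \<comment> \<open>The second component is invisible to the form, so it is left as an unspecified
    function \<open>f\<close>.\<close>
  then obtain f where f: "\<And>a x. phi A U d (a, x) = (d a, f a x)" by metis
  have "homogeneous_map (breve A) \<delta> (phi A U d)"
    using phi_homogeneous_derivation[OF A U d] by (simp add: homogeneous_derivation_def)
  then show ?thesis
    using hd z by (auto simp: homogeneous_compatible_def f)
qed

text \<open>By uniqueness of homogeneous components, \<open>d0\<close> and \<open>d1\<close> are the
  components of the sum. Applied to both \<open>A\<close> and \<open>breve A\<close>, this reduces
  the equivalence for general maps to the homogeneous one.\<close>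

lemma compatible_sum_iff:
  assumes g: "graded_space A" and h0: "homogeneous_map A 0 d0" and h1: "homogeneous_map A 1 d1"
  shows "compatible A (d0 + d1) \<longleftrightarrow> homogeneous_compatible A 0 d0 \<and> homogeneous_compatible A 1 d1"
proof -
  interpret vector_space "smul A" using g by (simp add: graded_space_def)
  have "Vector_Spaces.linear (smul A) (smul A) (d0 + d1)"
    using h0 h1
    by (auto simp: homogeneous_map_def Vector_Spaces.linear_iff scale_right_distrib algebra_simps)
  moreover have "(\<forall>\<delta>. P \<delta>) \<longleftrightarrow> P 0 \<and> P 1" for P :: "bit \<Rightarrow> bool"
    by (metis bit.exhaust)
  ultimately show ?thesis
    by (simp add: compatible_def map_component_unique[OF g h0 h1])
qed

theorem proposition4p2:
  fixes A :: "('k::field_char_0, 'v::ab_group_add) superalg" and U :: "'v set"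
  assumes "omega_Lie_superalgebra A"
    and "graded_subspace A U"
    and "direct_sum (derived A) U"
  shows "\<forall>d\<in>QDer A. phi A U d \<in> Der (breve A) \<and>
           (compatible (breve A) (phi A U d) \<longleftrightarrow> compatible A d)"
proof
  fix d assume "d \<in> QDer A"
  then obtain d0 d1 where q: "homogeneous_quasiderivation A 0 d0" "homogeneous_quasiderivation A 1 d1"
    and d: "d = d0 + d1"
    using QDer_decompose[OF assms(1)] by blast
  have g: "graded_space A" using assms(1) by (simp add: omega_Lie_superalgebra_def)
  have gB: "graded_space (breve A)" using graded_space_breve[OF g] .
  interpret E: vector_space "end_smul A"
    using g by (intro vector_space_end_smul) (simp add: graded_space_def)
  interpret EB: vector_space "end_smul (breve A)"
    using gB by (intro vector_space_end_smul) (simp add: graded_space_def)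
  have "d0 \<in> QDer A" "d1 \<in> QDer A"
    unfolding QDer_def using q by (auto intro: E.span_base)
  \<comment> \<open>Since each \<open>phi A U di\<close> has the degree of \<open>di\<close>, this
    splitting is the decomposition of \<open>phi A U d\<close> into its even and odd
    components.\<close>
  then have phi: "phi A U d = phi A U d0 + phi A U d1"
    unfolding d using phi_linear(1)[OF assms] by blast
  note D = phi_homogeneous_derivation[OF assms q(1)] phi_homogeneous_derivation[OF assms q(2)]
  have hB: "homogeneous_map (breve A) 0 (phi A U d0)" "homogeneous_map (breve A) 1 (phi A U d1)"
    using D unfolding homogeneous_derivation_def by blast+
  have h: "homogeneous_map A 0 d0" "homogeneous_map A 1 d1"
    using q unfolding homogeneous_quasiderivation_def by blast+
  have "phi A U d \<in> Der (breve A)"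
    unfolding phi Der_def using D by (blast intro: EB.span_add EB.span_base)
  \<comment> \<open>Both sides become conjunctions over the two degrees, which agree conjunct by
    conjunct.\<close>
  moreover have "compatible (breve A) (phi A U d) \<longleftrightarrow> compatible A d"
    unfolding phi compatible_sum_iff[OF gB hB] unfolding d compatible_sum_iff[OF g h]
      phi_homogeneous_compatible_iff[OF assms q(1)] phi_homogeneous_compatible_iff[OF assms q(2)] ..
  ultimately show "phi A U d \<in> Der (breve A) \<and>
      (compatible (breve A) (phi A U d) \<longleftrightarrow> compatible A d)" ..
qed

end
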